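(* Let $\mathbf{L}$ be a residuated lattice. Consider the equations $\mathsf{(LPL)}$: $(x\backslash y\wedge \mathrm{e})\vee(y\backslash x\wedge \mathrm{e})\approx \mathrm{e}$; $\mathsf{(LPL2)}$: $(y\wedge z)\backslash x\approx (y\backslash x)\vee(z\backslash x)$; $\mathsf{(LPL3)}$: $x\backslash(y\vee z)\approx (x\backslash y)\vee(x\backslash z)$. Then the following hold. (a) If $\mathbf{L}$ satisfies $\mathsf{(LPL)}$, then it satisfies $\mathsf{(LPL2)}$ and $\mathsf{(LPL3)}$. (b) If $\mathbf{L}$ satisfies $\mathrm{e}\wedge(y\vee z)\approx(\mathrm{e}\wedge y)\vee(\mathrm{e}\wedge z)$, then the equations $\mathsf{(LPL)}$, $\mathsf{(LPL2)}$ and $\mathsf{(LPL3)}$ are equivalent for $\mathbf{L}$ (that is, $\mathbf{L}$ satisfies any one of them if and only if it satisfies each of the others). (c) If $\mathbf{L}$ satisfies $\mathsf{(LPL3)}$ and $x\backslash x\approx \mathrm{e}$, then the lattice reduct of $\mathbf{L}$ is distributive; in particular, any prelinear cancellative residuated lattice has a distributive lattice reduct.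
   Context: A residuated lattice is an algebra $\langle L,\wedge,\vee,\cdot,\backslash,/,\mathrm{e}\rangle$ such that $\langle L,\cdot,\mathrm{e}\rangle$ is a monoid, $\langle L,\wedge,\vee\rangle$ is a lattice, and for all $a,b,d\in L$: $ab\le d \iff a\le d/b \iff b\le a\backslash d$. (The residuals $\backslash,/$ bind more strongly than $\wedge,\vee$.) It is cancellative if its monoid reduct is a cancellative monoid. It is prelinear if it satisfies both $(x\backslash y\wedge \mathrm{e})\vee(y\backslash x\wedge \mathrm{e})\approx \mathrm{e}$ and $(x/y\wedge \mathrm{e})\vee(y/x\wedge \mathrm{e})\approx \mathrm{e}$. *)

theory Defs
  imports Main
begin

unbundle lattice_syntax

text \<open>
  The algebra has the whole type as its universe, with unit \<open>1\<close>. The residuals are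
  written \<open>x \<setminus> y\<close> for \<open>x\y\<close> and \<open>x \<oslash> y\<close> for \<open>x/y\<close>; they bind more strongly than
  meet and join.
\<close>

class residuated_lattice = lattice + monoid_mult +
  fixes lres :: "'a \<Rightarrow> 'a \<Rightarrow> 'a"  (infix "\<setminus>" 75)
    and rres :: "'a \<Rightarrow> 'a \<Rightarrow> 'a"  (infix "\<oslash>" 75)
  assumes mult_le_iff_le_rres: "a * b \<le> d \<longleftrightarrow> a \<le> d \<oslash> b"
    and mult_le_iff_le_lres: "a * b \<le> d \<longleftrightarrow> b \<le> a \<setminus> d"

text \<open>
  Properties of the algebra as a whole take the type as an argument:
  \<open>LPL TYPE('a)\<close> says that the residuated lattice \<open>'a\<close> satisfies the equation (LPL).
\<close>

definition LPL :: "'a::residuated_lattice itself \<Rightarrow> bool" where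
  "LPL L \<longleftrightarrow> (\<forall>x y::'a. (x \<setminus> y \<sqinter> 1) \<squnion> (y \<setminus> x \<sqinter> 1) = 1)"

definition RPL :: "'a::residuated_lattice itself \<Rightarrow> bool" where
  "RPL L \<longleftrightarrow> (\<forall>x y::'a. (x \<oslash> y \<sqinter> 1) \<squnion> (y \<oslash> x \<sqinter> 1) = 1)"

definition LPL2 :: "'a::residuated_lattice itself \<Rightarrow> bool" where
  "LPL2 L \<longleftrightarrow> (\<forall>x y z::'a. (y \<sqinter> z) \<setminus> x = (y \<setminus> x) \<squnion> (z \<setminus> x))"

definition LPL3 :: "'a::residuated_lattice itself \<Rightarrow> bool" where
  "LPL3 L \<longleftrightarrow> (\<forall>x y z::'a. x \<setminus> (y \<squnion> z) = (x \<setminus> y) \<squnion> (x \<setminus> z))"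

definition prelinear :: "'a::residuated_lattice itself \<Rightarrow> bool" where
  "prelinear L \<longleftrightarrow> LPL L \<and> RPL L"

definition cancellative :: "'a::residuated_lattice itself \<Rightarrow> bool" where
  "cancellative L \<longleftrightarrow>
     (\<forall>a b c::'a. (a * b = a * c \<longrightarrow> b = c) \<and> (b * a = c * a \<longrightarrow> b = c))"

definition distributive_lattice :: "'a::lattice itself \<Rightarrow> bool" where
  "distributive_lattice L \<longleftrightarrow>
     class.distrib_lattice (inf :: 'a \<Rightarrow> 'a \<Rightarrow> 'a) (\<le>) (<) sup"

end

theory Submission
  imports Defs
begin

text \<open>
  Multiplication preserves joins in each argument, because each translation has a residual as
  right adjoint. So whenever \<open>s \<squnion> t = 1\<close>, every element splits as \<open>a = a * s \<squnion> a * t = s * a \<squnion> t * a\<close>,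
  and an inequality \<open>a \<le> b \<squnion> c\<close> reduces to \<open>a * s \<le> b\<close> and \<open>a * t \<le> c\<close> (or their mirror images).

  Under (LPL) one splits along \<open>y \<setminus> z \<sqinter> 1\<close> and \<open>z \<setminus> y \<sqinter> 1\<close>. The factor \<open>y \<setminus> z \<sqinter> 1\<close> pushes both \<open>y\<close>
  and \<open>y \<squnion> z\<close> below \<open>z\<close> and never increases an element; applied to \<open>x \<setminus> (y \<squnion> z)\<close> on the right
  this yields (LPL3), and applied to \<open>(y \<sqinter> z) \<setminus> x\<close> on the left it yields (LPL2). Conversely, both
  (LPL2) and (LPL3), specialised to the self-residual of \<open>x \<sqinter> y\<close> or of \<open>x \<squnion> y\<close>, give
  \<open>1 \<le> x \<setminus> y \<squnion> y \<setminus> x\<close>; this turns into (LPL) as soon as meeting with \<open>1\<close> distributes over joins.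

  For distributivity, (LPL3) together with \<open>x \<setminus> x = 1\<close> makes \<open>(y \<squnion> z) \<setminus> y\<close> and \<open>(y \<squnion> z) \<setminus> z\<close>
  join to \<open>1\<close>. Splitting \<open>x \<sqinter> (y \<squnion> z)\<close> along them sends the two parts below \<open>x \<sqinter> y\<close> and \<open>x \<sqinter> z\<close>.
  Cancellation supplies \<open>x \<setminus> x = 1\<close>, since \<open>x * (x \<setminus> x) = x\<close> holds in every residuated lattice.
\<close>

context residuated_lattice
begin

lemma le_lres_iff: "b \<le> a \<setminus> d \<longleftrightarrow> a * b \<le> d"
  by (simp add: mult_le_iff_le_lres)

lemma mult_lres_le: "a * (a \<setminus> d) \<le> d"
  by (simp flip: le_lres_iff)

lemma one_le_lres_self: "1 \<le> a \<setminus> a"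
  by (simp add: le_lres_iff)

lemma mult_left_mono': "b \<le> c \<Longrightarrow> a * b \<le> a * c"
  by (meson mult_le_iff_le_lres order_refl order_trans)

lemma mult_right_mono': "a \<le> b \<Longrightarrow> a * c \<le> b * c"
  by (meson mult_le_iff_le_rres order_refl order_trans)

lemma mult_le_if_le_one: "s \<le> 1 \<Longrightarrow> a * s \<le> a"
  using mult_left_mono'[of s 1 a] by simp

lemma mult_sup_le_iff: "a * (s \<squnion> t) \<le> d \<longleftrightarrow> a * s \<le> d \<and> a * t \<le> d"
  by (simp add: mult_le_iff_le_lres)

lemma sup_mult_le_iff: "(s \<squnion> t) * a \<le> d \<longleftrightarrow> s * a \<le> d \<and> t * a \<le> d"
  by (simp add: mult_le_iff_le_rres)

lemma lres_mono: "a \<le> b \<Longrightarrow> c \<setminus> a \<le> c \<setminus> b"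
  by (meson le_lres_iff mult_lres_le order_trans)

lemma lres_antimono: "a \<le> b \<Longrightarrow> b \<setminus> c \<le> a \<setminus> c"
  by (meson le_lres_iff mult_lres_le mult_right_mono' order_trans)

lemma le_sup_by_right_split:
  assumes "s \<squnion> t = 1" "a * s \<le> b" "a * t \<le> c"
  shows "a \<le> b \<squnion> c"
proof -
  have "a * (s \<squnion> t) \<le> b \<squnion> c"
    unfolding mult_sup_le_iff using assms(2,3) by (blast intro: le_supI1 le_supI2)
  then show ?thesis using assms(1) by simp
qed

lemma le_sup_by_left_split:
  assumes "s \<squnion> t = 1" "s * a \<le> b" "t * a \<le> c"
  shows "a \<le> b \<squnion> c"
proof -
  have "(s \<squnion> t) * a \<le> b \<squnion> c"
    unfolding sup_mult_le_iff using assms(2,3) by (blast intro: le_supI1 le_supI2)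
  then show ?thesis using assms(1) by simp
qed

lemma mult_negative_lres_le_inf: "y * (y \<setminus> z \<sqinter> 1) \<le> y \<sqinter> z"
  by (metis inf_greatest inf_le1 inf_le2 le_lres_iff mult_le_if_le_one)

lemma sup_mult_negative_lres_le: "(y \<squnion> z) * (y \<setminus> z \<sqinter> 1) \<le> z"
  unfolding sup_mult_le_iff by (meson inf_le1 inf_le2 le_lres_iff mult_le_if_le_one)

text \<open>
  One half of the splitting argument for (LPL2): since \<open>y * (y \<setminus> z \<sqinter> 1)\<close> lies below \<open>y \<sqinter> z\<close>,
  multiplying it by \<open>(y \<sqinter> z) \<setminus> x\<close> stays below \<open>x\<close>.
\<close>

lemma negative_lres_mult_inf_lres_le: "(y \<setminus> z \<sqinter> 1) * ((y \<sqinter> z) \<setminus> x) \<le> y \<setminus> x"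
proof -
  have "y * (y \<setminus> z \<sqinter> 1) * ((y \<sqinter> z) \<setminus> x) \<le> (y \<sqinter> z) * ((y \<sqinter> z) \<setminus> x)"
    by (intro mult_right_mono' mult_negative_lres_le_inf)
  also have "\<dots> \<le> x" by (rule mult_lres_le)
  finally show ?thesis by (simp add: le_lres_iff mult.assoc)
qed

text \<open>
  The corresponding half for (LPL3): \<open>x * (x \<setminus> (y \<squnion> z))\<close> lies below \<open>y \<squnion> z\<close>, which the factor
  \<open>y \<setminus> z \<sqinter> 1\<close> takes below \<open>z\<close>.
\<close>

lemma lres_sup_mult_negative_lres_le: "(x \<setminus> (y \<squnion> z)) * (y \<setminus> z \<sqinter> 1) \<le> x \<setminus> z"
proof -
  have "x * (x \<setminus> (y \<squnion> z)) * (y \<setminus> z \<sqinter> 1) \<le> (y \<squnion> z) * (y \<setminus> z \<sqinter> 1)"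
    by (intro mult_right_mono' mult_lres_le)
  also have "\<dots> \<le> z" by (rule sup_mult_negative_lres_le)
  finally show ?thesis by (simp add: le_lres_iff mult.assoc)
qed

end

lemma LPL_imp_LPL2:
  assumes "LPL TYPE('a::residuated_lattice)"
  shows "LPL2 TYPE('a)"
  unfolding LPL2_def
proof (intro allI antisym)
  fix x y z :: 'a
  have "(y \<setminus> z \<sqinter> 1) \<squnion> (z \<setminus> y \<sqinter> 1) = 1"
    using assms by (simp add: LPL_def)
  moreover have "(z \<setminus> y \<sqinter> 1) * ((y \<sqinter> z) \<setminus> x) \<le> z \<setminus> x"
    using negative_lres_mult_inf_lres_le[of z y x] by (simp add: inf_commute)
  ultimately show "(y \<sqinter> z) \<setminus> x \<le> (y \<setminus> x) \<squnion> (z \<setminus> x)"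
    by (blast intro: le_sup_by_left_split negative_lres_mult_inf_lres_le)
  show "(y \<setminus> x) \<squnion> (z \<setminus> x) \<le> (y \<sqinter> z) \<setminus> x"
    by (simp add: lres_antimono)
qed

lemma LPL_imp_LPL3:
  assumes "LPL TYPE('a::residuated_lattice)"
  shows "LPL3 TYPE('a)"
  unfolding LPL3_def
proof (intro allI antisym)
  fix x y z :: 'a
  have "(z \<setminus> y \<sqinter> 1) \<squnion> (y \<setminus> z \<sqinter> 1) = 1"
    using assms by (simp add: LPL_def)
  moreover have "(x \<setminus> (y \<squnion> z)) * (z \<setminus> y \<sqinter> 1) \<le> x \<setminus> y"
    using lres_sup_mult_negative_lres_le[of x z y] by (simp add: sup_commute)
  ultimately show "x \<setminus> (y \<squnion> z) \<le> (x \<setminus> y) \<squnion> (x \<setminus> z)"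
    by (blast intro: le_sup_by_right_split lres_sup_mult_negative_lres_le)
  show "(x \<setminus> y) \<squnion> (x \<setminus> z) \<le> x \<setminus> (y \<squnion> z)"
    by (simp add: lres_mono)
qed

lemma LPL2_imp_one_le_sup_lres:
  fixes x y :: "'a::residuated_lattice"
  assumes "LPL2 TYPE('a)"
  shows "1 \<le> x \<setminus> y \<squnion> y \<setminus> x"
proof -
  have "1 \<le> (x \<sqinter> y) \<setminus> (x \<sqinter> y)" by (rule one_le_lres_self)
  also have "\<dots> = x \<setminus> (x \<sqinter> y) \<squnion> y \<setminus> (x \<sqinter> y)"
    using assms by (simp add: LPL2_def)
  also have "\<dots> \<le> x \<setminus> y \<squnion> y \<setminus> x" by (intro sup_mono lres_mono) simp_all
  finally show ?thesis .
qed

lemma LPL3_imp_one_le_sup_lres: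
  fixes x y :: "'a::residuated_lattice"
  assumes "LPL3 TYPE('a)"
  shows "1 \<le> x \<setminus> y \<squnion> y \<setminus> x"
proof -
  have "1 \<le> (y \<squnion> x) \<setminus> (y \<squnion> x)" by (rule one_le_lres_self)
  also have "\<dots> = (y \<squnion> x) \<setminus> y \<squnion> (y \<squnion> x) \<setminus> x"
    using assms by (simp add: LPL3_def)
  also have "\<dots> \<le> x \<setminus> y \<squnion> y \<setminus> x" by (intro sup_mono lres_antimono) simp_all
  finally show ?thesis .
qed

lemma LPL_if_one_le_sup_lres:
  assumes distrib: "\<forall>y z::'a::residuated_lattice. 1 \<sqinter> (y \<squnion> z) = (1 \<sqinter> y) \<squnion> (1 \<sqinter> z)"
    and one_le: "\<And>x y::'a. 1 \<le> x \<setminus> y \<squnion> y \<setminus> x"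
  shows "LPL TYPE('a)"
  unfolding LPL_def
proof (intro allI)
  fix x y :: 'a
  have "(x \<setminus> y \<sqinter> 1) \<squnion> (y \<setminus> x \<sqinter> 1) = 1 \<sqinter> (x \<setminus> y \<squnion> y \<setminus> x)"
    using distrib by (simp add: inf_commute)
  also have "\<dots> = 1" using one_le by (simp add: inf_absorb1)
  finally show "(x \<setminus> y \<sqinter> 1) \<squnion> (y \<setminus> x \<sqinter> 1) = 1" .
qed

lemma distributive_lattice_if_inf_sup_le:
  assumes "\<And>x y z::'a::lattice. x \<sqinter> (y \<squnion> z) \<le> (x \<sqinter> y) \<squnion> (x \<sqinter> z)"
  shows "distributive_lattice TYPE('a)"
proof -
  have "x \<sqinter> (y \<squnion> z) = (x \<sqinter> y) \<squnion> (x \<sqinter> z)" for x y z :: 'a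
    by (intro antisym assms distrib_inf_le)
  then have "x \<squnion> (y \<sqinter> z) = (x \<squnion> y) \<sqinter> (x \<squnion> z)" for x y z :: 'a
    by (rule distrib_imp1)
  then show ?thesis
    unfolding distributive_lattice_def by unfold_locales
qed

lemma LPL3_lres_self_imp_distributive:
  assumes LPL3: "LPL3 TYPE('a::residuated_lattice)" and self: "\<forall>x::'a. x \<setminus> x = 1"
  shows "distributive_lattice TYPE('a)"
proof (rule distributive_lattice_if_inf_sup_le)
  fix x y z :: 'a
  let ?w = "x \<sqinter> (y \<squnion> z)" and ?s = "(y \<squnion> z) \<setminus> y" and ?t = "(y \<squnion> z) \<setminus> z"
  have split: "?s \<squnion> ?t = 1"
    using LPL3 self unfolding LPL3_def by metis
  have part: "?w * ((y \<squnion> z) \<setminus> v) \<le> x \<sqinter> v" if "(y \<squnion> z) \<setminus> v \<le> 1" for v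
  proof (rule inf_greatest)
    show "?w * ((y \<squnion> z) \<setminus> v) \<le> x"
      using mult_le_if_le_one[OF that] by (rule order_trans) simp
    have "?w * ((y \<squnion> z) \<setminus> v) \<le> (y \<squnion> z) * ((y \<squnion> z) \<setminus> v)"
      by (simp add: mult_right_mono')
    also have "\<dots> \<le> v" by (rule mult_lres_le)
    finally show "?w * ((y \<squnion> z) \<setminus> v) \<le> v" .
  qed
  have "?s \<le> 1" "?t \<le> 1" unfolding split[symmetric] by simp_all
  then show "?w \<le> (x \<sqinter> y) \<squnion> (x \<sqinter> z)"
    by (intro le_sup_by_right_split[OF split] part)
qed

lemma cancellative_imp_lres_self:
  fixes x :: "'a::residuated_lattice"
  assumes "cancellative TYPE('a)"
  shows "x \<setminus> x = 1"
proof -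
  have "x * 1 \<le> x * (x \<setminus> x)"
    by (intro mult_left_mono' one_le_lres_self)
  then have "x * (x \<setminus> x) = x * 1"
    by (simp add: antisym mult_lres_le)
  then show ?thesis
    using assms unfolding cancellative_def by blast
qed

theorem theorem4p2:
  shows "(LPL TYPE('a::residuated_lattice) \<longrightarrow> LPL2 TYPE('a) \<and> LPL3 TYPE('a)) \<and>
    ((\<forall>y z::'a. 1 \<sqinter> (y \<squnion> z) = (1 \<sqinter> y) \<squnion> (1 \<sqinter> z)) \<longrightarrow>
       (LPL TYPE('a) \<longleftrightarrow> LPL2 TYPE('a)) \<and>
       (LPL TYPE('a) \<longleftrightarrow> LPL3 TYPE('a)) \<and>
       (LPL2 TYPE('a) \<longleftrightarrow> LPL3 TYPE('a))) \<and>
    (LPL3 TYPE('a) \<and> (\<forall>x::'a. x \<setminus> x = 1) \<longrightarrow> distributive_lattice TYPE('a)) \<and>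
    (prelinear TYPE('a) \<and> cancellative TYPE('a) \<longrightarrow> distributive_lattice TYPE('a))"
proof (intro conjI[of "_ \<longrightarrow> _"] impI)
  assume "LPL TYPE('a)"
  then show "LPL2 TYPE('a) \<and> LPL3 TYPE('a)"
    by (simp add: LPL_imp_LPL2 LPL_imp_LPL3)
next
  assume distrib: "\<forall>y z::'a. 1 \<sqinter> (y \<squnion> z) = (1 \<sqinter> y) \<squnion> (1 \<sqinter> z)"
  have "LPL TYPE('a)" if "LPL2 TYPE('a)"
    using distrib LPL2_imp_one_le_sup_lres[OF that] by (rule LPL_if_one_le_sup_lres)
  moreover have "LPL TYPE('a)" if "LPL3 TYPE('a)"
    using distrib LPL3_imp_one_le_sup_lres[OF that] by (rule LPL_if_one_le_sup_lres)
  ultimately show "(LPL TYPE('a) \<longleftrightarrow> LPL2 TYPE('a)) \<and> (LPL TYPE('a) \<longleftrightarrow> LPL3 TYPE('a)) \<and>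
      (LPL2 TYPE('a) \<longleftrightarrow> LPL3 TYPE('a))"
    using LPL_imp_LPL2 LPL_imp_LPL3 by blast
next
  assume "LPL3 TYPE('a) \<and> (\<forall>x::'a. x \<setminus> x = 1)"
  then show "distributive_lattice TYPE('a)"
    by (simp add: LPL3_lres_self_imp_distributive)
next
  assume "prelinear TYPE('a) \<and> cancellative TYPE('a)"
  then show "distributive_lattice TYPE('a)"
    by (simp add: prelinear_def LPL_imp_LPL3 cancellative_imp_lres_self
        LPL3_lres_self_imp_distributive)
qed

end
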